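(* By using threshold payments, the mechanism Deterministic-EOM is truthful, budget feasible, and has an approximation ratio of $4.56$.
   Context: Setting. A buyer with budget $B>0$ faces a finite set $A$ of $n$ sellers. Seller $i$ owns one item (also called $i$) and has a private cost $c_i\ge 0$; his utility when selling at payment $p_i$ is $p_i-c_i$. The buyer's value $v:2^A\to\mathbb{R}_{\ge 0}$ is monotone non-decreasing and submodular. Write $v(i)=v(\{i\})$, $m_i(S)=v(S\cup\{i\})-v(S)$, $c(S)=\sum_{i\in S}c_i$, and $opt(A',B)=\max\{v(S):S\subseteq A',\ c(S)\le B\}$ for $A'\subseteq A$. A deterministic mechanism has approximation ratio $\rho$ if its winning set $S$ always satisfies $\rho\,v(S)\ge opt(A,B)$. Mechanisms. A deterministic allocation rule $f$ maps each declared cost vector $c$ to a winning set $f(c)\subseteq A$. Threshold payments: a winner $i$ is paid $p_i=\inf\{b: i\notin f(b,c_{-i})\}$, losers are paid $0$. The mechanism is truthful if declaring the true cost is always a dominant strategy for each seller, and budget feasible if for every cost vector the total payment is at most $B$. Greedy order. $S_0=\emptyset$ and $S_i=S_{i-1}\cup\{\arg\max_{j\in A\setminus S_{i-1}} m_j(S_{i-1})/c_j\}$, ties broken by a fixed order on sellers; the ratio is $0$ if $m_j(S_{i-1})=0$ and $+\infty$ if $c_j=0<m_j(S_{i-1})$. Items are renamed so that $S_i\setminus S_{i-1}=\{i\}$. Greedy-EOM$(\alpha,A,B)$: let $v^*=opt(A,B)$ and $k=1$; while $k\le|A|$ and $v(S_k)\le\alpha v^*$ increase $k$ by one; return $S_{k-1}$.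 Deterministic-EOM: replace $A$ by $\{i\in A:c_i\le B\}$ (return $\emptyset$ if this is empty); let $i^*\in\arg\max_{i\in A}v(i)$ (ties broken by a fixed order); let $w=opt(A\setminus\{i^*\},B)$; if $v(i^* )\ge\frac{\sqrt{17}-3}{4}\,w$ return $\{i^*\}$, otherwise return Greedy-EOM$(0.5,A,B)$.
   Formalization: The approximation ratio 4.56 is replaced by the exact constant (5+√17)/2 = 4.5615..., of which 4.56 is the rounding; read as exactly 4.56 the claim fails, since an additive instance with a tie for i* attains opt = (5+√17)/2 times the mechanism's value. *)

theory Defs
  imports Complex_Main "HOL-Library.Extended_Real" "HOL-Library.While_Combinator"
begin

section \<open>Valuations\<close>

definition submodular_on :: "'a set \<Rightarrow> ('a set \<Rightarrow> real) \<Rightarrow> bool" where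
  "submodular_on A v \<longleftrightarrow>
     (\<forall>S\<subseteq>A. \<forall>T\<subseteq>A. v (S \<union> T) + v (S \<inter> T) \<le> v S + v T)"

definition marginal :: "('a set \<Rightarrow> real) \<Rightarrow> 'a set \<Rightarrow> 'a \<Rightarrow> real" where
  "marginal v S i = v (S \<union> {i}) - v S"

definition opt :: "('a set \<Rightarrow> real) \<Rightarrow> ('a \<Rightarrow> real) \<Rightarrow> 'a set \<Rightarrow> real \<Rightarrow> real" where
  "opt v c A' B = Max {v S |S. S \<subseteq> A' \<and> sum c S \<le> B}"

section \<open>Mechanisms\<close>

text \<open>A cost vector is a total function on the type of sellers; its values outside the
  set of sellers are irrelevant.\<close>

definition cost_vectors :: "'a set \<Rightarrow> ('a \<Rightarrow> real) set" where
  "cost_vectors A = {c. \<forall>i\<in>A. 0 \<le> c i}"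

text \<open>The infimum ranges over admissible declarations \<open>b \<ge> 0\<close>. It is a real infimum, so it is
  meaningful only if some declaration makes \<open>i\<close> lose; \<open>deterministic_eom_over_budget\<close>
  below shows that this is so for the mechanism considered here.\<close>

definition threshold_payment ::
    "(('a \<Rightarrow> real) \<Rightarrow> 'a set) \<Rightarrow> ('a \<Rightarrow> real) \<Rightarrow> 'a \<Rightarrow> real" where
  "threshold_payment f c i =
     (if i \<in> f c then Inf {b. 0 \<le> b \<and> i \<notin> f (c(i := b))} else 0)"

definition utility ::
    "(('a \<Rightarrow> real) \<Rightarrow> 'a set) \<Rightarrow> (('a \<Rightarrow> real) \<Rightarrow> 'a \<Rightarrow> real) \<Rightarrow> 'a \<Rightarrow> real \<Rightarrow> ('a \<Rightarrow> real) \<Rightarrow> real" where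
  "utility f p i t c = (if i \<in> f c then p c i - t else p c i)"

text \<open>Here \<open>t\<close> is the true cost of seller \<open>i\<close> and \<open>c\<close> an arbitrary declared cost vector:
  whatever everybody declares, replacing \<open>c i\<close> by \<open>t\<close> does not hurt \<open>i\<close>.\<close>

definition truthful ::
    "'a set \<Rightarrow> (('a \<Rightarrow> real) \<Rightarrow> 'a set) \<Rightarrow> (('a \<Rightarrow> real) \<Rightarrow> 'a \<Rightarrow> real) \<Rightarrow> bool" where
  "truthful A f p \<longleftrightarrow>
     (\<forall>i\<in>A. \<forall>t\<ge>0. \<forall>c\<in>cost_vectors A. utility f p i t c \<le> utility f p i t (c(i := t)))"

definition budget_feasible ::
    "'a set \<Rightarrow> real \<Rightarrow> (('a \<Rightarrow> real) \<Rightarrow> 'a \<Rightarrow> real) \<Rightarrow> bool" where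
  "budget_feasible A B p \<longleftrightarrow> (\<forall>c\<in>cost_vectors A. (\<Sum>i\<in>A. p c i) \<le> B)"

definition has_approximation_ratio ::
    "'a set \<Rightarrow> ('a set \<Rightarrow> real) \<Rightarrow> real \<Rightarrow> (('a \<Rightarrow> real) \<Rightarrow> 'a set) \<Rightarrow> real \<Rightarrow> bool" where
  "has_approximation_ratio A v B f \<rho> \<longleftrightarrow>
     (\<forall>c\<in>cost_vectors A. \<rho> * v (f c) \<ge> opt v c A B)"

section \<open>The mechanism\<close>

text \<open>The maximiser of \<open>g\<close> on \<open>X\<close> that comes first in the linear order \<open>r\<close>.\<close>

definition argmax_first :: "('a \<times> 'a) set \<Rightarrow> ('a \<Rightarrow> 'b::linorder) \<Rightarrow> 'a set \<Rightarrow> 'a" where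
  "argmax_first r g X =
     (THE x. x \<in> X \<and> (\<forall>y\<in>X. g y \<le> g x) \<and> (\<forall>y\<in>X. g y = g x \<longrightarrow> (x, y) \<in> r))"

definition greedy_ratio :: "('a set \<Rightarrow> real) \<Rightarrow> ('a \<Rightarrow> real) \<Rightarrow> 'a set \<Rightarrow> 'a \<Rightarrow> ereal" where
  "greedy_ratio v c S j =
     (if marginal v S j = 0 then 0
      else if c j = 0 then \<infinity>
      else ereal (marginal v S j / c j))"

text \<open>\<open>greedy_prefix r v c A k\<close> is the set \<open>S\<^sub>k\<close>; only the values for \<open>k \<le> card A\<close> are
  meaningful.\<close>

primrec greedy_prefix ::
    "('a \<times> 'a) set \<Rightarrow> ('a set \<Rightarrow> real) \<Rightarrow> ('a \<Rightarrow> real) \<Rightarrow> 'a set \<Rightarrow> nat \<Rightarrow> 'a set" where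
  "greedy_prefix r v c A 0 = {}"
| "greedy_prefix r v c A (Suc k) =
     greedy_prefix r v c A k \<union>
       {argmax_first r (greedy_ratio v c (greedy_prefix r v c A k)) (A - greedy_prefix r v c A k)}"

definition greedy_eom ::
    "('a \<times> 'a) set \<Rightarrow> ('a set \<Rightarrow> real) \<Rightarrow> real \<Rightarrow> 'a set \<Rightarrow> real \<Rightarrow> ('a \<Rightarrow> real) \<Rightarrow> 'a set" where
  "greedy_eom r v \<alpha> A B c =
     (let S = greedy_prefix r v c A;
          k = while (\<lambda>k. k \<le> card A \<and> v (S k) \<le> \<alpha> * opt v c A B) Suc 1
      in S (k - 1))"

text \<open>The orders breaking ties in the greedy order (\<open>r\<close>) and in the choice of the most valuable
  single item (\<open>r'\<close>) need not coincide.\<close>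

definition deterministic_eom ::
    "('a \<times> 'a) set \<Rightarrow> ('a \<times> 'a) set \<Rightarrow> ('a set \<Rightarrow> real) \<Rightarrow> 'a set \<Rightarrow> real \<Rightarrow> ('a \<Rightarrow> real) \<Rightarrow> 'a set" where
  "deterministic_eom r r' v A B c =
     (let A' = {i \<in> A. c i \<le> B} in
      if A' = {} then {}
      else
        let i = argmax_first r' (\<lambda>j. v {j}) A';
            w = opt v c (A' - {i}) B
        in if v {i} \<ge> (sqrt 17 - 3) / 4 * w then {i}
           else greedy_eom r v (1/2) A' B c)"

subsection \<open>Sellers declaring more than the budget lose\<close>

lemma argmax_first_in:
  assumes "finite X" "X \<noteq> {}" "X \<subseteq> A" "linear_order_on A r"
  shows "argmax_first r g X \<in> X"
proof -
  define Y where "Y = {x \<in> X. g x = Max (g ` X)}"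
  have Max_in: "Max (g ` X) \<in> g ` X" using assms(1,2) by (intro Max_in) auto
  then obtain m where "m \<in> X" "g m = Max (g ` X)" by force
  then have Y: "finite Y" "Y \<noteq> {}" "Y \<subseteq> A" using assms by (auto simp: Y_def)
  have r: "refl_on A r" "trans r" "antisym r" "total_on A r"
    using assms(4) by (auto simp: linear_order_on_def partial_order_on_def preorder_on_def)
  have ex: "\<exists>x\<in>Y. \<forall>y\<in>Y. (x, y) \<in> r"
    using Y
  proof (induction Y rule: finite_ne_induct)
    case (singleton x)
    then show ?case using r(1) by (auto simp: refl_on_def)
  next
    case (insert a F)
    then obtain x where x: "x \<in> F" "\<forall>y\<in>F. (x, y) \<in> r" by auto
    have A: "a \<in> A" "x \<in> A" "a \<noteq> x" using insert x by auto
    then consider "(a, x) \<in> r" | "(x, a) \<in> r" using r(4) by (auto simp: total_on_def)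
    then show ?case
    proof cases
      case 1
      have "(a, y) \<in> r" if "y \<in> F" for y using r(2) 1 x(2) that by (meson transD)
      moreover have "(a, a) \<in> r" using r(1) A by (auto simp: refl_on_def)
      ultimately show ?thesis by auto
    qed (use x in auto)
  qed
  then obtain x where x: "x \<in> Y" "\<forall>y\<in>Y. (x, y) \<in> r" by blast
  have le: "g y \<le> Max (g ` X)" if "y \<in> X" for y using assms(1) that by auto
  have "argmax_first r g X = x"
    unfolding argmax_first_def
  proof (rule the_equality)
    show "x \<in> X \<and> (\<forall>y\<in>X. g y \<le> g x) \<and> (\<forall>y\<in>X. g y = g x \<longrightarrow> (x, y) \<in> r)"
      using x le by (auto simp: Y_def)
  next
    fix z assume z: "z \<in> X \<and> (\<forall>y\<in>X. g y \<le> g z) \<and> (\<forall>y\<in>X. g y = g z \<longrightarrow> (z, y) \<in> r)"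
    have "g z = g x" using z x le by (auto simp: Y_def intro!: order.antisym)
    then have "(z, x) \<in> r" "(x, z) \<in> r" using z x by (auto simp: Y_def)
    then show "z = x" using r(3) by (meson antisymD)
  qed
  then show ?thesis using x by (auto simp: Y_def)
qed

lemma greedy_prefix_subset:
  assumes "finite X" "X \<subseteq> A" "linear_order_on A r"
  shows "k \<le> card X \<Longrightarrow> greedy_prefix r v c X k \<subseteq> X \<and> card (greedy_prefix r v c X k) = k"
proof (induction k)
  case (Suc k)
  let ?S = "greedy_prefix r v c X k"
  have S: "?S \<subseteq> X" "card ?S = k" using Suc by auto
  have "X - ?S \<noteq> {}" using S Suc.prems by auto
  then have "argmax_first r (greedy_ratio v c ?S) (X - ?S) \<in> X - ?S"
    using assms by (intro argmax_first_in[of _ A]) auto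
  then show ?case using S finite_subset[OF S(1) assms(1)] by auto
qed simp

lemma greedy_eom_subset:
  assumes "finite X" "X \<subseteq> A" "linear_order_on A r"
  shows "greedy_eom r v \<alpha> X B c \<subseteq> X"
proof -
  let ?b = "\<lambda>k. k \<le> card X \<and> v (greedy_prefix r v c X k) \<le> \<alpha> * opt v c X B"
  have "while ?b Suc 1 \<le> Suc (card X)"
    by (rule while_rule[where P = "\<lambda>k. k \<le> Suc (card X)" and r = "measure (\<lambda>k. Suc (card X) - k)"])
      auto
  then have "while ?b Suc 1 - 1 \<le> card X" by simp
  from greedy_prefix_subset[OF assms this] show ?thesis
    by (simp add: greedy_eom_def Let_def)
qed

lemma deterministic_eom_over_budget:
  assumes "finite A" "linear_order_on A r" "linear_order_on A r'" "c i > B"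
  shows "i \<notin> deterministic_eom r r' v A B c"
proof -
  let ?A = "{i \<in> A. c i \<le> B}"
  have "greedy_eom r v (1/2) ?A B c \<subseteq> ?A"
    using assms by (intro greedy_eom_subset[of _ A]) auto
  moreover have "argmax_first r' (\<lambda>j. v {j}) ?A \<in> ?A" if "?A \<noteq> {}"
    using assms that by (intro argmax_first_in[of _ A]) auto
  ultimately have "deterministic_eom r r' v A B c \<subseteq> ?A"
    by (auto simp: deterministic_eom_def Let_def)
  then show ?thesis using assms(4) by auto
qed

end

theory Submission imports Defs begin

text \<open>
  Lowering a winner's bid only moves it forward in the greedy order and only enlarges the optimum,
  so the allocation rule is monotone, and threshold payments make it truthful.

  For budget feasibility, suppose that a winner \<open>i\<close> of the greedy branch, chosen after the prefix
  \<open>S\<close> at cost vector \<open>c\<close>, still wins when it raises its bid to \<open>b\<close>, now being chosen after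
  \<open>T \<supseteq> S\<close>. Comparing \<open>T \<union> {i}\<close> with the set that is optimal for the \<^emph>\<open>original\<close> costs, of value \<open>v\<^sup>*\<close>,
  the greedy choice of \<open>i\<close> gives \<open>v\<^sup>* - v (T \<union> {i}) \<le> B m\<^sub>i(T) / b\<close>, while the stopping rule gives
  \<open>v (T \<union> {i}) \<le> v\<^sup>* / 2\<close>. Hence \<open>b \<le> B m\<^sub>i(S) / (v\<^sup>* / 2)\<close>, and these bounds telescope along the greedy
  order to at most \<open>B\<close>.

  The approximation ratio is \<open>1 + 1/\<beta> = 1/(1/2 - \<beta>)\<close> for \<open>\<beta> = (sqrt 17 - 3)/4\<close>: in the first branch
  \<open>v\<^sup>* \<le> v(i\<^sup>*) + w\<close>, and in the second the greedy solution loses at most one item of value less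
  than \<open>\<beta> v\<^sup>*\<close> against \<open>v\<^sup>* / 2\<close>.
\<close>

section \<open>Maximisers with tie breaking\<close>

lemma argmax_first_eqI:
  assumes "linear_order_on A r" "x \<in> X"
    and "\<And>y. y \<in> X \<Longrightarrow> g y \<le> g x" and "\<And>y. y \<in> X \<Longrightarrow> g y = g x \<Longrightarrow> (x, y) \<in> r"
  shows "argmax_first r g X = x"
  unfolding argmax_first_def
proof (rule the_equality)
  fix z assume z: "z \<in> X \<and> (\<forall>y\<in>X. g y \<le> g z) \<and> (\<forall>y\<in>X. g y = g z \<longrightarrow> (z, y) \<in> r)"
  have "antisym r" using assms(1) by (auto simp: linear_order_on_def partial_order_on_def)
  moreover have "g z = g x" using z assms by (auto intro!: order.antisym)
  ultimately show "z = x" using z assms by (auto dest: antisymD)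
qed (use assms in auto)

lemma argmax_first_props:
  assumes "finite X" "X \<noteq> {}" "X \<subseteq> A" "linear_order_on A r"
  shows "argmax_first r g X \<in> X"
    and "y \<in> X \<Longrightarrow> g y \<le> g (argmax_first r g X)"
    and "y \<in> X \<Longrightarrow> g y = g (argmax_first r g X) \<Longrightarrow> (argmax_first r g X, y) \<in> r"
proof -
  have r: "refl_on A r" "trans r" "total_on A r"
    using assms(4) by (auto simp: linear_order_on_def partial_order_on_def preorder_on_def)
  have "\<exists>x\<in>X. (\<forall>y\<in>X. g y \<le> g x) \<and> (\<forall>y\<in>X. g y = g x \<longrightarrow> (x, y) \<in> r)"
    using assms(1-3)
  proof (induction X rule: finite_ne_induct)
    case (singleton x)
    then show ?case using r(1) by (auto simp: refl_on_def)
  next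
    case (insert a F)
    then obtain x where x: "x \<in> F" "\<forall>y\<in>F. g y \<le> g x" "\<forall>y\<in>F. g y = g x \<longrightarrow> (x, y) \<in> r"
      by auto
    have A: "a \<in> A" "x \<in> A" "a \<noteq> x" "(a, a) \<in> r"
      using insert x r(1) by (auto simp: refl_on_def)
    \<comment> \<open>In the first two cases the old maximiser \<open>x\<close> survives, in the
      last two \<open>a\<close> takes its place.\<close>
    then consider "g a < g x" | "g a = g x" "(x, a) \<in> r" | "g a = g x" "(a, x) \<in> r" | "g x < g a"
      using r(3) by (metis linorder_less_linear total_on_def)
    then show ?case
    proof cases
      case 3
      then have "(a, y) \<in> r" if "y \<in> F" "g y = g x" for y
        using r(2) x(3) that by (meson transD)
      then show ?thesis using 3 A x by auto
    next
      case 4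
      then have "\<forall>y\<in>F. g y < g a" using x by fastforce
      then show ?thesis using A by fastforce
    qed (use x in \<open>auto intro!: bexI[of _ x]\<close>)
  qed
  then obtain x where x: "x \<in> X" "\<forall>y\<in>X. g y \<le> g x" "\<forall>y\<in>X. g y = g x \<longrightarrow> (x, y) \<in> r"
    by blast
  then have "argmax_first r g X = x" using assms(4) by (intro argmax_first_eqI) auto
  with x show "argmax_first r g X \<in> X"
    "y \<in> X \<Longrightarrow> g y \<le> g (argmax_first r g X)"
    "y \<in> X \<Longrightarrow> g y = g (argmax_first r g X) \<Longrightarrow> (argmax_first r g X, y) \<in> r" by auto
qed

section \<open>The optimum\<close>

lemma opt_ge:
  assumes "finite X" "S \<subseteq> X" "sum c S \<le> B"
  shows "v S \<le> opt v c X B"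
  unfolding opt_def using assms by (intro Max_ge) auto

lemma opt_attained:
  assumes "finite X" "0 \<le> B"
  obtains S where "S \<subseteq> X" "sum c S \<le> B" "opt v c X B = v S"
proof -
  \<comment> \<open>Since \<open>0 \<le> B\<close>, the empty set is feasible, so the maximum ranges
    over a nonempty set.\<close>
  have "opt v c X B \<in> {v S |S. S \<subseteq> X \<and> sum c S \<le> B}"
    unfolding opt_def using assms by (intro Max_in) (auto intro!: exI[of _ "{}"])
  then show ?thesis using that by auto
qed

lemma opt_antimono_cost:
  assumes "finite X" "0 \<le> B" "\<And>j. j \<in> X \<Longrightarrow> c j \<le> c' j"
  shows "opt v c' X B \<le> opt v c X B"
proof -
  obtain S where S: "S \<subseteq> X" "sum c' S \<le> B" "opt v c' X B = v S"
    using opt_attained[OF assms(1,2)] by metis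
  have "sum c S \<le> sum c' S" using S assms(3) by (intro sum_mono) auto
  then show ?thesis using S assms(1) by (auto intro!: opt_ge)
qed

lemma opt_cong_cost:
  assumes "finite X" "0 \<le> B" "\<And>j. j \<in> X \<Longrightarrow> c j = c' j"
  shows "opt v c X B = opt v c' X B"
  using assms by (intro antisym opt_antimono_cost) auto

lemma opt_mono_set:
  assumes "finite Y" "0 \<le> B" "X \<subseteq> Y"
  shows "opt v c X B \<le> opt v c Y B"
proof -
  obtain S where "S \<subseteq> X" "sum c S \<le> B" "opt v c X B = v S"
    using opt_attained[of X B c v] finite_subset[OF assms(3,1)] assms(2) by metis
  then show ?thesis using assms by (auto intro!: opt_ge)
qed

text \<open>With nonnegative costs, an item dearer than \<open>B\<close> lies in no feasible
  set.\<close>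

lemma opt_affordable:
  assumes "finite A" "0 \<le> B" "\<And>i. i \<in> A \<Longrightarrow> 0 \<le> c i"
  shows "opt v c {i \<in> A. c i \<le> B} B = opt v c A B"
proof (rule antisym)
  obtain S where S: "S \<subseteq> A" "sum c S \<le> B" "opt v c A B = v S"
    using opt_attained[OF assms(1,2)] by metis
  have "c i \<le> B" if "i \<in> S" for i
    using member_le_sum[of i S c] that S assms finite_subset[of S A] by force
  then show "opt v c A B \<le> opt v c {i \<in> A. c i \<le> B} B"
    using S assms by (auto intro!: opt_ge)
qed (use assms in \<open>auto intro: opt_mono_set\<close>)

section \<open>Truthfulness of threshold payments\<close>

text \<open>The price of a winner depends only on the other bids. By monotonicity a cost
  \<open>t\<close> that wins is at most every losing bid, so truth earns
  \<open>Inf ?L - t \<ge> 0\<close>; a bid can only change winning into losing and back.\<close>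

lemma truthful_threshold_payment:
  assumes mono: "\<And>c i a b. c \<in> cost_vectors A \<Longrightarrow> i \<in> A \<Longrightarrow> 0 \<le> a \<Longrightarrow> a \<le> b \<Longrightarrow>
      i \<in> f (c(i := b)) \<Longrightarrow> i \<in> f (c(i := a))"
    and lose: "\<And>c i. c \<in> cost_vectors A \<Longrightarrow> i \<in> A \<Longrightarrow> \<exists>b\<ge>0. i \<notin> f (c(i := b))"
  shows "truthful A f (threshold_payment f)"
  unfolding truthful_def
proof (intro ballI allI impI)
  fix i c and t :: real assume i: "i \<in> A" and t: "0 \<le> t" and c: "c \<in> cost_vectors A"
  let ?L = "{b. 0 \<le> b \<and> i \<notin> f (c(i := b))}"
  have bdd: "bdd_below ?L" by (auto intro: bdd_belowI[of _ 0])
  have ne: "?L \<noteq> {}" using lose[OF c i] by auto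
  show "utility f (threshold_payment f) i t c \<le> utility f (threshold_payment f) i t (c(i := t))"
  proof (cases "i \<in> f (c(i := t))")
    case True
    have "t \<le> Inf ?L"
    proof (rule cInf_greatest[OF ne])
      fix b assume b: "b \<in> ?L"
      show "t \<le> b"
      proof (rule ccontr)
        assume "\<not> t \<le> b"
        then show False using mono[OF c i, of b t] b True by auto
      qed
    qed
    then show ?thesis using True by (auto simp: utility_def threshold_payment_def)
  next
    case False
    \<comment> \<open>Here \<open>t\<close> is itself a losing bid, so winning by misreporting pays
      at most \<open>t\<close> and gains nothing.\<close>
    then have "Inf ?L \<le> t" using t bdd by (intro cInf_lower) auto
    then show ?thesis using False by (auto simp: utility_def threshold_payment_def)
  qed
qed

text \<open>The infimum lies below every losing bid, hence below every \<open>b > x\<close>, and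
  density of the reals closes the gap. The condition \<open>0 \<le> x\<close> also covers losers,
  who are paid 0.\<close>

lemma threshold_payment_le:
  assumes "0 \<le> x" "\<And>b. x < b \<Longrightarrow> i \<notin> f (c(i := b))"
  shows "threshold_payment f c i \<le> x"
proof -
  have "Inf {b. 0 \<le> b \<and> i \<notin> f (c(i := b))} \<le> b" if "x < b" for b
    using that assms by (intro cInf_lower) (auto intro: bdd_belowI[of _ 0])
  then show ?thesis using assms(1) by (auto simp: threshold_payment_def intro: dense_ge)
qed

section \<open>Monotone submodular valuations and the greedy order\<close>

locale monotone_submodular =
  fixes A :: "'a set" and v :: "'a set \<Rightarrow> real"
  assumes finite_A: "finite A"
    and nonneg: "S \<subseteq> A \<Longrightarrow> 0 \<le> v S"
    and mono_v: "mono_on (Pow A) v"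
    and submodular: "submodular_on A v"
begin

lemma v_mono: "S \<subseteq> T \<Longrightarrow> T \<subseteq> A \<Longrightarrow> v S \<le> v T"
  using mono_v by (auto simp: mono_on_def)

lemma marginal_nonneg: "S \<subseteq> A \<Longrightarrow> i \<in> A \<Longrightarrow> 0 \<le> marginal v S i"
  using v_mono[of S "S \<union> {i}"] by (auto simp: marginal_def)

text \<open>For \<open>i \<notin> T\<close> this is submodularity of \<open>S \<union> {i}\<close>
  and \<open>T\<close>, which meet in \<open>S\<close>; for \<open>i \<in> T\<close> the left side
  is 0.\<close>

lemma marginal_antimono:
  assumes "S \<subseteq> T" "T \<subseteq> A" "i \<in> A"
  shows "marginal v T i \<le> marginal v S i"
proof (cases "i \<in> T")
  case True
  then have "T \<union> {i} = T" by auto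
  then show ?thesis using marginal_nonneg[of S i] assms by (simp add: marginal_def)
next
  case False
  have "S \<union> {i} \<subseteq> A" using assms by auto
  then have "v ((S \<union> {i}) \<union> T) + v ((S \<union> {i}) \<inter> T) \<le> v (S \<union> {i}) + v T"
    using submodular assms(2) unfolding submodular_on_def by blast
  moreover have "(S \<union> {i}) \<union> T = T \<union> {i}" "(S \<union> {i}) \<inter> T = S" using False assms by auto
  ultimately show ?thesis by (simp add: marginal_def)
qed

lemma v_Un_le_marginals:
  assumes "T \<subseteq> A" "U \<subseteq> A"
  shows "v (T \<union> U) \<le> v T + (\<Sum>i\<in>U. marginal v T i)"
proof -
  have "finite U" using assms finite_A by (auto intro: finite_subset)
  then show ?thesis using assms(2)
  proof (induction U)
    case (insert x F)
    have "marginal v (T \<union> F) x \<le> marginal v T x"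
      using insert assms by (intro marginal_antimono) auto
    then show ?case using insert by (simp add: marginal_def)
  qed simp
qed

text \<open>The value \<open>v {}\<close> may be positive, so \<open>v {i}\<close> only bounds the
  marginal of \<open>i\<close> at the empty set from above.\<close>

lemma v_insert_le:
  assumes "T \<subseteq> A" "i \<in> A"
  shows "v (T \<union> {i}) \<le> v T + v {i}"
  using marginal_antimono[of "{}" T i] nonneg[of "{}"] assms by (simp add: marginal_def)

end

text \<open>The set \<open>X\<close> is kept apart from \<open>A\<close> because the greedy order
  runs on the affordable sellers, who vary with the declared costs.\<close>

locale greedy = monotone_submodular A v for A :: "'a set" and v +
  fixes r :: "('a \<times> 'a) set" and X :: "'a set" and B :: real
  assumes order: "linear_order_on A r" and X: "X \<subseteq> A" and B: "0 \<le> B"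
begin

section \<open>Prefixes and picks of the greedy order\<close>

abbreviation prefix :: "('a \<Rightarrow> real) \<Rightarrow> nat \<Rightarrow> 'a set" where
  "prefix c \<equiv> greedy_prefix r v c X"

abbreviation pick :: "('a \<Rightarrow> real) \<Rightarrow> nat \<Rightarrow> 'a" where
  "pick c k \<equiv> argmax_first r (greedy_ratio v c (prefix c k)) (X - prefix c k)"

lemma finite_X: "finite X"
  using X finite_A by (rule finite_subset)

lemma prefix_subset: "k \<le> card X \<Longrightarrow> prefix c k \<subseteq> X"
  using greedy_prefix_subset[OF finite_X X order] by blast

lemma pick_props:
  assumes "k < card X"
  shows "pick c k \<in> X - prefix c k"
    and "j \<in> X - prefix c k \<Longrightarrow>
      greedy_ratio v c (prefix c k) j \<le> greedy_ratio v c (prefix c k) (pick c k)"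
    and "j \<in> X - prefix c k \<Longrightarrow>
      greedy_ratio v c (prefix c k) j = greedy_ratio v c (prefix c k) (pick c k) \<Longrightarrow> (pick c k, j) \<in> r"
proof -
  have "card (prefix c k) = k" "prefix c k \<subseteq> X"
    using greedy_prefix_subset[OF finite_X X order, of k v c] assms by auto
  then have "X - prefix c k \<noteq> {}" using assms by auto
  moreover have "finite (X - prefix c k)" "X - prefix c k \<subseteq> A" using finite_X X by auto
  ultimately have *: "finite (X - prefix c k)" "X - prefix c k \<noteq> {}" "X - prefix c k \<subseteq> A" by auto
  note props = argmax_first_props[OF * order, where g = "greedy_ratio v c (prefix c k)"]
  show "pick c k \<in> X - prefix c k" by (rule props(1))
  show "greedy_ratio v c (prefix c k) j \<le> greedy_ratio v c (prefix c k) (pick c k)"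
    if "j \<in> X - prefix c k" using that by (rule props(2))
  show "(pick c k, j) \<in> r" if "j \<in> X - prefix c k"
    "greedy_ratio v c (prefix c k) j = greedy_ratio v c (prefix c k) (pick c k)"
    using that by (rule props(3))
qed

lemma prefix_mono: "k \<le> l \<Longrightarrow> prefix c k \<subseteq> prefix c l"
  by (rule lift_Suc_mono_le[of "prefix c"]) auto

lemma v_prefix_mono: "k \<le> l \<Longrightarrow> l \<le> card X \<Longrightarrow> v (prefix c k) \<le> v (prefix c l)"
  using prefix_mono[of k l c] prefix_subset[of l c] X by (intro v_mono) auto

lemma prefix_first:
  assumes "i \<in> prefix c l"
  obtains k where "k < l" "i \<notin> prefix c k" "i = pick c k"
  using assms
proof (induction l arbitrary: thesis)
  case (Suc l)
  show ?case
  proof (cases "i \<in> prefix c l")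
    case True
    then obtain k where "k < l" "i \<notin> prefix c k" "i = pick c k" by (rule Suc.IH[rotated])
    then show ?thesis by (intro Suc.prems(1)[of k]) auto
  next
    case False
    then show ?thesis using Suc.prems(2) by (intro Suc.prems(1)[of l]) auto
  qed
qed simp

section \<open>Response of ratios and prefixes to a changed bid\<close>

lemma greedy_ratio_mono:
  assumes "S \<subseteq> A" "j \<in> A" "0 \<le> c j" "c j \<le> c' j"
  shows "greedy_ratio v c' S j \<le> greedy_ratio v c S j"
  using assms marginal_nonneg[OF assms(1,2)]
  by (auto simp: greedy_ratio_def intro!: divide_left_mono)

text \<open>Cross-multiplying removes the extended reals. As \<open>c i > 0\<close>, the ratio of
  \<open>i\<close> is finite, so an item \<open>j\<close> of cost 0 must have marginal 0.\<close>

lemma greedy_ratio_le_imp: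
  assumes "S \<subseteq> A" "i \<in> A" "j \<in> A" "0 < c i" "0 \<le> c j"
    and "greedy_ratio v c S j \<le> greedy_ratio v c S i"
  shows "c i * marginal v S j \<le> c j * marginal v S i"
  using assms marginal_nonneg[OF assms(1,2)] marginal_nonneg[OF assms(1,3)]
  by (auto simp: greedy_ratio_def zero_ereal_def divide_simps mult_ac split: if_splits)

text \<open>A higher bid lowers only the ratio of \<open>i\<close>. In a round that \<open>i\<close>
  did not win, the pick therefore stays the same, including its tie breaking.\<close>

lemma prefix_raise:
  assumes "i \<in> X" "0 \<le> c i" "c i \<le> b" "k \<le> card X" "i \<notin> prefix c k"
  shows "prefix (c(i := b)) k = prefix c k"
  using assms(4,5)
proof (induction k)
  case (Suc k)
  let ?c = "c(i := b)" and ?S = "prefix c k" and ?x = "pick c k"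
  have IH: "prefix ?c k = ?S" using Suc.prems by (intro Suc.IH) auto
  have k: "k < card X" and S: "?S \<subseteq> A" using Suc.prems prefix_subset[of k c] X by auto
  have ne: "?x \<noteq> i" using Suc.prems by auto
  have same: "greedy_ratio v ?c ?S j = greedy_ratio v c ?S j" if "j \<noteq> i" for j
    using that by (simp add: greedy_ratio_def)
  have le: "greedy_ratio v ?c ?S j \<le> greedy_ratio v c ?S j" for j
    using greedy_ratio_mono[of ?S i c ?c] same[of j] S assms X by (cases "j = i") auto
  have "argmax_first r (greedy_ratio v ?c ?S) (X - ?S) = ?x"
  proof (rule argmax_first_eqI[OF order])
    fix j assume j: "j \<in> X - ?S"
    show "greedy_ratio v ?c ?S j \<le> greedy_ratio v ?c ?S ?x"
      using pick_props(2)[OF k j] le[of j] same[OF ne] by simp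
    assume "greedy_ratio v ?c ?S j = greedy_ratio v ?c ?S ?x"
    \<comment> \<open>Every tie at the raised bid was a tie before: the old ratio of
      \<open>j\<close> is squeezed between its new ratio and the unchanged ratio of
      \<open>?x\<close>.\<close>
    then have "greedy_ratio v c ?S j = greedy_ratio v c ?S ?x"
      using pick_props(2)[OF k j] le[of j] same[OF ne] by simp
    then show "(?x, j) \<in> r" by (rule pick_props(3)[OF k j])
  qed (rule pick_props(1)[OF k])
  then show ?case using IH by (simp del: fun_upd_apply)
qed simp

section \<open>Stopping rule, winners and winning bids of Greedy-EOM\<close>

lemma greedy_eom_prefix:
  obtains m where "greedy_eom r v \<alpha> X B c = prefix c m" "m \<le> card X"
    "m = 0 \<or> v (prefix c m) \<le> \<alpha> * opt v c X B"
    "m = card X \<or> \<alpha> * opt v c X B < v (prefix c (Suc m))"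
proof -
  let ?b = "\<lambda>k. k \<le> card X \<and> v (prefix c k) \<le> \<alpha> * opt v c X B"
  \<comment> \<open>The loop counter is one ahead of the returned prefix, and the test starts at 1.
    The empty prefix is thus never tested, hence the exception \<open>k = 1\<close>.\<close>
  let ?P = "\<lambda>k. 1 \<le> k \<and> k \<le> Suc (card X) \<and>
    (k = 1 \<or> v (prefix c (k - 1)) \<le> \<alpha> * opt v c X B)"
  have "?P (while ?b Suc 1) \<and> \<not> ?b (while ?b Suc 1)"
    by (rule while_rule[where P = ?P and r = "measure (\<lambda>k. Suc (card X) - k)"]) auto
  moreover define k where "k = while ?b Suc 1"
  ultimately have k: "?P k" "\<not> ?b k" by auto
  show ?thesis
  proof (rule that[of "k - 1"])
    show "greedy_eom r v \<alpha> X B c = prefix c (k - 1)"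
      by (simp add: greedy_eom_def Let_def k_def)
  qed (use k in auto)
qed

text \<open>Removes the loop from all later arguments. Values of prefixes increase, so one later
  prefix passing the test forces all earlier ones to pass.\<close>

lemma mem_greedy_eom_iff:
  "i \<in> greedy_eom r v \<alpha> X B c \<longleftrightarrow>
    (\<exists>l\<le>card X. i \<in> prefix c l \<and> v (prefix c l) \<le> \<alpha> * opt v c X B)"
proof -
  obtain m where m: "greedy_eom r v \<alpha> X B c = prefix c m" "m \<le> card X"
    "m = 0 \<or> v (prefix c m) \<le> \<alpha> * opt v c X B"
    "m = card X \<or> \<alpha> * opt v c X B < v (prefix c (Suc m))"
    by (rule greedy_eom_prefix)
  show ?thesis
  proof
    assume i: "i \<in> greedy_eom r v \<alpha> X B c"
    then have "m \<noteq> 0" using m(1) by (cases m) auto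
    then show "\<exists>l\<le>card X. i \<in> prefix c l \<and> v (prefix c l) \<le> \<alpha> * opt v c X B"
      using i m by auto
  next
    assume "\<exists>l\<le>card X. i \<in> prefix c l \<and> v (prefix c l) \<le> \<alpha> * opt v c X B"
    then obtain l where l: "l \<le> card X" "i \<in> prefix c l" "v (prefix c l) \<le> \<alpha> * opt v c X B"
      by auto
    have "l \<le> m"
    proof (rule ccontr)
      assume "\<not> l \<le> m"
      then show False using m(4) l v_prefix_mono[of "Suc m" l c] by auto
    qed
    then show "i \<in> greedy_eom r v \<alpha> X B c" using prefix_mono l(2) m(1) by blast
  qed
qed

lemma greedy_eom_lower_cost:
  assumes "i \<in> X" "0 \<le> c i" "c i \<le> b" "0 \<le> \<alpha>"
    and "i \<in> greedy_eom r v \<alpha> X B (c(i := b))"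
  shows "i \<in> greedy_eom r v \<alpha> X B c"
proof -
  let ?c = "c(i := b)"
  obtain m where m: "m \<le> card X" "i \<in> prefix ?c m" "v (prefix ?c m) \<le> \<alpha> * opt v ?c X B"
    using assms(5) mem_greedy_eom_iff by auto
  \<comment> \<open>If \<open>i\<close> were not among the first \<open>m\<close> picks at
    \<open>c\<close>, raising its bid would leave those picks unchanged and still without
    \<open>i\<close>.\<close>
  have "i \<in> prefix c m" using prefix_raise[where c = c, OF assms(1-3), of m] m by auto
  then obtain l where l: "l < m" "i \<notin> prefix c l" "i = pick c l" by (rule prefix_first)
  have eq: "prefix ?c l = prefix c l" using prefix_raise[where c = c, OF assms(1-3), of l] l m by simp
  have "prefix c (Suc l) \<subseteq> prefix ?c m"
    using l m(2) eq prefix_mono[of l m ?c] by auto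
  then have "v (prefix c (Suc l)) \<le> v (prefix ?c m)"
    using m(1) prefix_subset[of m ?c] X by (intro v_mono) auto
  moreover have "opt v ?c X B \<le> opt v c X B"
    using finite_X B assms by (intro opt_antimono_cost) auto
  then have "\<alpha> * opt v ?c X B \<le> \<alpha> * opt v c X B" using assms(4) by (intro mult_left_mono)
  ultimately show ?thesis
    unfolding mem_greedy_eom_iff using m l by (intro exI[of _ "Suc l"]) auto
qed

text \<open>The product form remains meaningful when \<open>b\<close> or the optimum is 0; division
  is deferred until the optimum is known to be positive.\<close>

lemma greedy_eom_winning_bid_le:
  assumes c: "\<And>j. j \<in> X \<Longrightarrow> 0 \<le> c j" and l: "l < card X" and i: "i = pick c l"
    and b: "c i \<le> b" and win: "i \<in> greedy_eom r v (1/2) X B (c(i := b))"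
  shows "b * (opt v c X B / 2) \<le> B * (v (prefix c (Suc l)) - v (prefix c l))"
proof -
  let ?c = "c(i := b)"
  have iX: "i \<in> X" and il: "i \<notin> prefix c l" using pick_props(1)[OF l] i by auto
  have b0: "0 \<le> b" using c[OF iX] b by simp
  have gain: "v (prefix c (Suc l)) - v (prefix c l) = marginal v (prefix c l) i"
    by (simp add: marginal_def i)
  obtain m where m: "m \<le> card X" "i \<in> prefix ?c m" "v (prefix ?c m) \<le> 1/2 * opt v ?c X B"
    using win mem_greedy_eom_iff by auto
  obtain p where p: "p < m" "i \<notin> prefix ?c p" "i = pick ?c p"
    using m(2) by (rule prefix_first)
  define T where "T = prefix ?c p"
  have pX: "p < card X" and TA: "T \<subseteq> A" and iA: "i \<in> A"
    using p m prefix_subset[of p ?c] X iX by (auto simp: T_def)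
  have "prefix ?c l = prefix c l" using prefix_raise[where c = c, OF iX c[OF iX] b] l il by simp
  \<comment> \<open>Otherwise \<open>i\<close> would occur among the first \<open>l\<close> picks at
    the raised bid, which agree with \<open>prefix c l\<close>.\<close>
  moreover have "l \<le> p"
  proof (rule ccontr)
    assume "\<not> l \<le> p"
    then have "prefix ?c (Suc p) \<subseteq> prefix ?c l" by (intro prefix_mono) auto
    then show False using p(3) il \<open>prefix ?c l = prefix c l\<close> by auto
  qed
  ultimately have "prefix c l \<subseteq> T" using prefix_mono[of l p ?c] by (simp add: T_def)
  then have T_marginal: "marginal v T i \<le> marginal v (prefix c l) i"
    using TA iA by (intro marginal_antimono)
  have "T \<union> {i} \<subseteq> prefix ?c m" using p m prefix_mono[of p m ?c] by (auto simp: T_def)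
  then have "v (T \<union> {i}) \<le> v (prefix ?c m)"
    using m(1) prefix_subset[of m ?c] X by (intro v_mono) auto
  moreover have "opt v ?c X B \<le> opt v c X B"
    using finite_X B b by (intro opt_antimono_cost) auto
  ultimately have half: "v (T \<union> {i}) \<le> opt v c X B / 2" using m(3) by simp
  obtain U where U: "U \<subseteq> X" "sum c U \<le> B" "opt v c X B = v U"
    using opt_attained[OF finite_X B] by metis
  have UA: "U \<subseteq> A" using U(1) X by auto
  \<comment> \<open>The set \<open>U\<close> is priced at \<open>c\<close>, but the greedy choice of
    \<open>i\<close> is made at \<open>?c\<close>. The two differ only at \<open>i\<close>, whose
    marginal at \<open>T \<union> {i}\<close> vanishes; every other item outside \<open>T\<close>
    had a ratio at most that of \<open>i\<close>.\<close>
  have step: "b * marginal v (T \<union> {i}) j \<le> c j * marginal v T i" if j: "j \<in> U" for j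
  proof (cases "j \<in> T \<union> {i} \<or> b = 0")
    case True
    then have "b * marginal v (T \<union> {i}) j = 0"
      by (auto simp: marginal_def insert_absorb)
    then show ?thesis using marginal_nonneg[OF TA iA] c j U(1) by auto
  next
    case False
    have jA: "j \<in> A" using j UA by auto
    have "j \<in> X - prefix ?c p" using False j U by (auto simp: T_def)
    from pick_props(2)[OF pX this]
    have "greedy_ratio v ?c T j \<le> greedy_ratio v ?c T i" using p(3) by (simp add: T_def)
    moreover have "0 < ?c i" "0 \<le> ?c j" using False b0 c j U by auto
    ultimately have "?c i * marginal v T j \<le> ?c j * marginal v T i"
      using TA iA jA by (intro greedy_ratio_le_imp)
    then have "b * marginal v T j \<le> c j * marginal v T i" using False by auto
    moreover have "marginal v (T \<union> {i}) j \<le> marginal v T j"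
      using TA iA jA by (intro marginal_antimono) auto
    ultimately show ?thesis using mult_left_mono[OF _ b0] by fastforce
  qed
  have "opt v c X B \<le> v ((T \<union> {i}) \<union> U)"
    unfolding U(3) using TA iA UA by (intro v_mono) auto
  also have "\<dots> \<le> v (T \<union> {i}) + (\<Sum>j\<in>U. marginal v (T \<union> {i}) j)"
    using TA iA UA by (intro v_Un_le_marginals) auto
  \<comment> \<open>As \<open>T \<union> {i}\<close> has at most half the optimal value, the items
    of \<open>U\<close> must supply the other half; their total cost at \<open>c\<close> is at most
    \<open>B\<close>.\<close>
  finally have "opt v c X B / 2 \<le> (\<Sum>j\<in>U. marginal v (T \<union> {i}) j)" using half by simp
  then have "b * (opt v c X B / 2) \<le> b * (\<Sum>j\<in>U. marginal v (T \<union> {i}) j)"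
    using b0 by (rule mult_left_mono)
  also have "\<dots> \<le> sum c U * marginal v T i"
    unfolding sum_distrib_left sum_distrib_right using step by (rule sum_mono)
  also have "\<dots> \<le> B * marginal v T i" using U(2) marginal_nonneg[OF TA iA] by (rule mult_right_mono)
  also have "\<dots> \<le> B * marginal v (prefix c l) i" using T_marginal B by (rule mult_left_mono)
  finally show ?thesis unfolding gain .
qed

text \<open>Bounds proportional to the gain of each round telescope.\<close>

lemma sum_prefix_le:
  assumes "m \<le> card X"
    and "\<And>l. l < m \<Longrightarrow> p (pick c l) \<le> C * (v (prefix c (Suc l)) - v (prefix c l))"
  shows "(\<Sum>i\<in>prefix c m. p i) \<le> C * (v (prefix c m) - v {})"
  using assms
proof (induction m)
  case (Suc m)
  have "finite (prefix c m)" using Suc.prems prefix_subset[of m c] finite_X finite_subset by auto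
  moreover have "pick c m \<notin> prefix c m" using pick_props(1)[of m c] Suc.prems by auto
  ultimately have "(\<Sum>i\<in>prefix c (Suc m). p i) = (\<Sum>i\<in>prefix c m. p i) + p (pick c m)" by simp
  also have "\<dots> \<le> C * (v (prefix c m) - v {}) + C * (v (prefix c (Suc m)) - v (prefix c m))"
    using Suc.prems by (intro add_mono Suc.IH) auto
  finally show ?case by (simp add: algebra_simps)
qed simp

text \<open>Either all of \<open>X\<close> is returned, or the next pick would push the value above
  half the optimum while adding at most \<open>z\<close>.\<close>

lemma greedy_eom_value:
  assumes "\<And>j. j \<in> X \<Longrightarrow> v {j} \<le> z" "0 \<le> z" "0 < opt v c X B"
  shows "opt v c X B / 2 \<le> v (greedy_eom r v (1/2) X B c) + z"
proof -
  obtain m where m: "greedy_eom r v (1/2) X B c = prefix c m" "m \<le> card X"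
    "m = 0 \<or> v (prefix c m) \<le> 1/2 * opt v c X B"
    "m = card X \<or> 1/2 * opt v c X B < v (prefix c (Suc m))"
    by (rule greedy_eom_prefix)
  have S: "prefix c m \<subseteq> X" using m(2) by (rule prefix_subset)
  show ?thesis
  proof (cases "m = card X")
    case True
    then have "prefix c m = X"
      using greedy_prefix_subset[OF finite_X X order, of m v c] finite_X
      by (metis card_subset_eq order_refl)
    moreover obtain U where "U \<subseteq> X" "opt v c X B = v U"
      using opt_attained[OF finite_X B] by metis
    ultimately have "opt v c X B \<le> v (prefix c m)" using X by (auto intro: v_mono)
    then show ?thesis using m(1) assms by simp
  next
    case False
    then have "pick c m \<in> X" using m(2) pick_props(1)[of m c] by auto
    then have "v (prefix c (Suc m)) \<le> v (prefix c m) + z"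
      using v_insert_le[of "prefix c m" "pick c m"] assms(1)[of "pick c m"] S X by fastforce
    then show ?thesis using False m by simp
  qed
qed

end

section \<open>The mechanism Deterministic-EOM\<close>

locale deterministic_mechanism = monotone_submodular A v for A :: "'a set" and v +
  fixes r r' :: "('a \<times> 'a) set" and B :: real
  assumes B: "0 < B" and order: "linear_order_on A r" and order': "linear_order_on A r'"
begin

abbreviation mech :: "('a \<Rightarrow> real) \<Rightarrow> 'a set" where
  "mech \<equiv> deterministic_eom r r' v A B"

definition affordable :: "('a \<Rightarrow> real) \<Rightarrow> 'a set" where
  "affordable c = {i \<in> A. c i \<le> B}"

definition best :: "('a \<Rightarrow> real) \<Rightarrow> 'a" where
  "best c = argmax_first r' (\<lambda>j. v {j}) (affordable c)"

definition single :: "('a \<Rightarrow> real) \<Rightarrow> bool" where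
  "single c \<longleftrightarrow> (sqrt 17 - 3) / 4 * opt v c (affordable c - {best c}) B \<le> v {best c}"

lemma mem_affordable [simp]: "i \<in> affordable c \<longleftrightarrow> i \<in> A \<and> c i \<le> B"
  by (simp add: affordable_def)

lemma finite_affordable [simp]: "finite (affordable c)"
  using finite_A by (simp add: affordable_def)

lemma mech_eq:
  "mech c = (if affordable c = {} then {} else if single c then {best c}
    else greedy_eom r v (1/2) (affordable c) B c)"
  unfolding deterministic_eom_def Let_def affordable_def best_def single_def by (rule refl)

lemma greedy_affordable: "greedy A v r (affordable c) B"
  using order B by unfold_locales auto

lemma best_props:
  assumes "affordable c \<noteq> {}"
  shows "best c \<in> affordable c" "j \<in> affordable c \<Longrightarrow> v {j} \<le> v {best c}"
proof -
  have "affordable c \<subseteq> A" by auto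
  note props = argmax_first_props[OF finite_affordable assms this order', folded best_def]
  show "best c \<in> affordable c" unfolding best_def by (rule props(1))
  show "v {j} \<le> v {best c}" if "j \<in> affordable c"
    unfolding best_def using that by (rule props(2))
qed

lemma over_budget: "B < c i \<Longrightarrow> i \<notin> mech c"
  using deterministic_eom_over_budget finite_A order order' by metis

lemma ratio_const_pos: "0 < (sqrt 17 - 3) / (4 :: real)"
  by (simp add: real_less_rsqrt)

section \<open>Choice of the branch after a changed bid, and truthfulness\<close>

lemma affordable_upd:
  assumes "c i \<le> B" "b \<le> B"
  shows "affordable (c(i := b)) = affordable c" and "best (c(i := b)) = best c"
proof -
  show "affordable (c(i := b)) = affordable c"
    using assms by (auto simp: affordable_def split: if_splits)
  then show "best (c(i := b)) = best c" unfolding best_def by (simp only:)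
qed

text \<open>The optimum in the branch test leaves out the best seller, whose bid within the budget
  therefore cannot influence the test.\<close>

lemma single_upd_best:
  assumes "c i \<le> B" "b \<le> B" "i = best c"
  shows "single (c(i := b)) \<longleftrightarrow> single c"
proof -
  have "opt v (c(i := b)) (affordable c - {best c}) B = opt v c (affordable c - {best c}) B"
    using finite_A B assms(3) by (intro opt_cong_cost) auto
  then show ?thesis
    unfolding single_def affordable_upd[where c = c, OF assms(1,2)] by (simp only:)
qed

lemma single_raise:
  assumes "c i \<le> b" "b \<le> B" "single c"
  shows "single (c(i := b))"
proof -
  have cB: "c i \<le> B" using assms by simp
  have "opt v (c(i := b)) (affordable c - {best c}) B \<le> opt v c (affordable c - {best c}) B"
    using finite_A B assms(1) by (intro opt_antimono_cost) auto
  then have "(sqrt 17 - 3) / 4 * opt v (c(i := b)) (affordable c - {best c}) B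
      \<le> (sqrt 17 - 3) / 4 * opt v c (affordable c - {best c}) B"
    using ratio_const_pos by (intro mult_left_mono) auto
  then show ?thesis 
    using assms(3) unfolding single_def affordable_upd[where c = c, OF cB assms(2)] by linarith
qed

text \<open>A lower bid keeps a winner in its branch: a single winner has no influence on the test,
  and by \<open>single_raise\<close> lowering a bid cannot leave the greedy branch. Within that
  branch \<open>greedy_eom_lower_cost\<close> applies.\<close>

lemma mech_lower_cost:
  assumes "i \<in> A" "0 \<le> c i" "c i \<le> b" "i \<in> mech (c(i := b))"
  shows "i \<in> mech c"
proof -
  let ?c = "c(i := b)"
  interpret greedy A v r "affordable c" B by (rule greedy_affordable)
  have "\<not> B < ?c i" using over_budget assms(4) by blast
  then have bB: "b \<le> B" by simp
  then have cB: "c i \<le> B" using assms(3) by simp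
  note eq = affordable_upd[where c = c, OF cB bB]
  have ne: "affordable c \<noteq> {}" using cB assms(1) by auto
  show ?thesis
  proof (cases "single ?c")
    case True
    then have i: "i = best c"
      using assms(4) ne unfolding mech_eq[of ?c] eq by (simp only: if_True if_False singleton_iff)
    then have "single c" using single_upd_best[where c = c, OF cB bB] True by blast
    with i show ?thesis using ne by (simp only: mech_eq[of c] if_True if_False singleton_iff)
  next
    case False
    then have single: "\<not> single c" using single_raise[where c = c, OF assms(3) bB] by blast
    have iX: "i \<in> affordable c" using assms(1) cB by simp
    have "i \<in> greedy_eom r v (1/2) (affordable c) B ?c"
      using False assms(4) ne unfolding mech_eq[of ?c] eq by (simp only: if_False)
    then have "i \<in> greedy_eom r v (1/2) (affordable c) B c"
      by (rule greedy_eom_lower_cost[where c = c, OF iX assms(2,3), rotated]) simp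
    then show ?thesis using ne single by (simp only: mech_eq[of c] if_False)
  qed
qed

lemma mech_truthful: "truthful A mech (threshold_payment mech)"
proof (rule truthful_threshold_payment)
  fix c i and a b :: real
  assume "i \<in> A" "0 \<le> a" "a \<le> b" "i \<in> mech (c(i := b))"
  then show "i \<in> mech (c(i := a))" using mech_lower_cost[of i "c(i := a)" b] by simp
next
  fix c i
  show "\<exists>b\<ge>0. i \<notin> mech (c(i := b))"
    using over_budget[of "c(i := B + 1)" i] B by (intro exI[of _ "B + 1"]) auto
qed

section \<open>Budget feasibility\<close>

lemma not_single_opt_pos:
  assumes "affordable c \<noteq> {}" "\<not> single c"
  shows "v {best c} < (sqrt 17 - 3) / 4 * opt v c (affordable c) B"
    and "0 < opt v c (affordable c) B"
proof -
  have "opt v c (affordable c - {best c}) B \<le> opt v c (affordable c) B"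
    using finite_A B by (intro opt_mono_set) auto
  then have "(sqrt 17 - 3) / 4 * opt v c (affordable c - {best c}) B
      \<le> (sqrt 17 - 3) / 4 * opt v c (affordable c) B"
    using ratio_const_pos by (intro mult_left_mono) auto
  then show *: "v {best c} < (sqrt 17 - 3) / 4 * opt v c (affordable c) B"
    using assms(2) unfolding single_def by linarith
  have "0 \<le> v {best c}" using best_props(1)[OF assms(1)] by (intro nonneg) auto
  then show "0 < opt v c (affordable c) B"
    using * ratio_const_pos by (smt (verit) zero_less_mult_pos)
qed

text \<open>It must be excluded that \<open>i\<close> wins at a high bid by switching branches. A
  single winner is the best seller, and its bid cannot have turned the test around.\<close>

lemma greedy_payment_le:
  assumes c: "c \<in> cost_vectors A" and ns: "\<not> single c"
    and l: "l < card (affordable c)"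
    and i: "i = argmax_first r (greedy_ratio v c (greedy_prefix r v c (affordable c) l))
      (affordable c - greedy_prefix r v c (affordable c) l)"
    and win: "i \<in> greedy_eom r v (1/2) (affordable c) B c"
  shows "threshold_payment mech c i \<le> B / (opt v c (affordable c) B / 2) *
    (v (greedy_prefix r v c (affordable c) (Suc l)) - v (greedy_prefix r v c (affordable c) l))"
proof (rule threshold_payment_le)
  interpret greedy A v r "affordable c" B by (rule greedy_affordable)
  have iX: "i \<in> affordable c" using pick_props(1)[OF l] i by auto
  have opt_pos: "0 < opt v c (affordable c) B"
    using iX ns by (intro not_single_opt_pos) auto
  show "0 \<le> B / (opt v c (affordable c) B / 2) * (v (prefix c (Suc l)) - v (prefix c l))"
    using v_prefix_mono[of l "Suc l" c] l opt_pos B by (intro mult_nonneg_nonneg) auto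
  fix b assume b: "B / (opt v c (affordable c) B / 2) * (v (prefix c (Suc l)) - v (prefix c l)) < b"
  have bid: "x \<le> B / (opt v c (affordable c) B / 2) * (v (prefix c (Suc l)) - v (prefix c l))"
    if "c i \<le> x" "i \<in> greedy_eom r v (1/2) (affordable c) B (c(i := x))" for x
  proof -
    have "x * (opt v c (affordable c) B / 2) \<le> B * (v (prefix c (Suc l)) - v (prefix c l))"
      using that c l i by (intro greedy_eom_winning_bid_le) (auto simp: cost_vectors_def)
    then show ?thesis using opt_pos by (simp add: field_simps)
  qed
  \<comment> \<open>The original bid wins too, so it obeys the same bound and lies below
    \<open>b\<close>.\<close>
  have cb: "c i \<le> b" using bid[of "c i"] win b by simp
  show "i \<notin> mech (c(i := b))"
  proof
    assume *: "i \<in> mech (c(i := b))"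
    have cB: "c i \<le> B" using iX by simp
    have "\<not> B < (c(i := b)) i" using over_budget * by blast
    then have bB: "b \<le> B" by simp
    note eq = affordable_upd[where c = c, OF cB bB]
    have ne: "affordable c \<noteq> {}" using iX by blast
    have "\<not> single (c(i := b))"
    proof
      assume s: "single (c(i := b))"
      then have "i = best c" using * ne unfolding mech_eq[of "c(i := b)"] eq
        by (simp only: if_True if_False singleton_iff)
      then show False using single_upd_best[where c = c, OF cB bB] s ns by blast
    qed
    then have "i \<in> greedy_eom r v (1/2) (affordable c) B (c(i := b))"
      using * ne unfolding mech_eq[of "c(i := b)"] eq by (simp only: if_False)
    then show False using bid[OF cb] b by simp
  qed
qed

lemma mech_budget_feasible: "budget_feasible A B (threshold_payment mech)"
  unfolding budget_feasible_def
proof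
  fix c assume c: "c \<in> cost_vectors A"
  interpret greedy A v r "affordable c" B by (rule greedy_affordable)
  have zero: "threshold_payment mech c i = 0" if "i \<notin> mech c" for i
    using that by (simp add: threshold_payment_def)
  have sum_eq: "(\<Sum>i\<in>A. threshold_payment mech c i) = (\<Sum>i\<in>S. threshold_payment mech c i)"
    if "mech c = S" "S \<subseteq> A" for S
    using that zero finite_A by (intro sum.mono_neutral_right) auto
  consider "affordable c = {}" | "affordable c \<noteq> {}" "single c" | "affordable c \<noteq> {}" "\<not> single c"
    by blast
  then show "(\<Sum>i\<in>A. threshold_payment mech c i) \<le> B"
  proof cases
    case 1
    then have "mech c = {}" by (simp add: mech_eq)
    then show ?thesis using sum_eq[of "{}"] B by simp
  next
    case 2
    then have "mech c = {best c}" by (simp add: mech_eq)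
    \<comment> \<open>Every bid above \<open>B\<close> loses, so the single winner is paid at most
      \<open>B\<close>.\<close>
    moreover have "threshold_payment mech c (best c) \<le> B"
      using B over_budget by (intro threshold_payment_le) auto
    ultimately show ?thesis using sum_eq[of "{best c}"] best_props(1)[OF 2(1)] by auto
  next
    case 3
    let ?K = "opt v c (affordable c) B / 2"
    have K: "0 < ?K" using not_single_opt_pos[OF 3] by simp
    have mech: "mech c = greedy_eom r v (1/2) (affordable c) B c" using 3 by (simp add: mech_eq)
    obtain m where m: "greedy_eom r v (1/2) (affordable c) B c = prefix c m"
      "m \<le> card (affordable c)" "m = 0 \<or> v (prefix c m) \<le> 1/2 * opt v c (affordable c) B"
      by (rule greedy_eom_prefix)
    have "(\<Sum>i\<in>A. threshold_payment mech c i) = (\<Sum>i\<in>prefix c m. threshold_payment mech c i)"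
      using mech m prefix_subset[OF m(2), of c] by (intro sum_eq) auto
    also have "\<dots> \<le> B / ?K * (v (prefix c m) - v {})"
    proof (rule sum_prefix_le[OF m(2)])
      fix l assume l: "l < m"
      have "pick c l \<in> prefix c (Suc l)" by simp
      then have "pick c l \<in> prefix c m" using prefix_mono[of "Suc l" m c] l by auto
      then show "threshold_payment mech c (pick c l)
          \<le> B / ?K * (v (prefix c (Suc l)) - v (prefix c l))"
        using c 3(2) l m by (intro greedy_payment_le) auto
    qed
    also have "\<dots> \<le> B / ?K * ?K"
    proof (rule mult_left_mono)
      \<comment> \<open>For \<open>m = 0\<close> the difference is 0; otherwise the stopping rule
        bounds the value of the prefix and \<open>v {}\<close> is nonnegative.\<close>
      show "v (prefix c m) - v {} \<le> ?K" using m(3) nonneg[of "{}"] K by auto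
    qed (use B K in simp)
    also have "\<dots> = B" using K by simp
    finally show ?thesis .
  qed
qed

section \<open>Approximation ratio\<close>

lemma mech_approximation: "has_approximation_ratio A v B mech ((5 + sqrt 17) / 2)"
  unfolding has_approximation_ratio_def
proof
  fix c assume c: "c \<in> cost_vectors A"
  interpret greedy A v r "affordable c" B by (rule greedy_affordable)
  let ?s = "sqrt 17 :: real"
  have s: "?s * ?s = 17" "3 < ?s" "?s < 5"
    by (auto intro: real_less_rsqrt real_less_lsqrt)
  have opt: "opt v c A B = opt v c (affordable c) B"
    using opt_affordable[of A B c v] finite_A B c
    by (auto simp: cost_vectors_def affordable_def)
  obtain U where U: "U \<subseteq> affordable c" "sum c U \<le> B" "opt v c (affordable c) B = v U"
    using opt_attained[OF finite_X greedy.B[OF greedy_affordable]] by metis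
  consider "affordable c = {}" | "affordable c \<noteq> {}" "single c" | "affordable c \<noteq> {}" "\<not> single c"
    by blast
  then show "opt v c A B \<le> (5 + ?s) / 2 * v (mech c)"
  proof cases
    case 1
    then have "opt v c A B = v {}" "mech c = {}" using opt U by (auto simp: mech_eq)
    moreover have "1 * v {} \<le> (5 + ?s) / 2 * v {}"
      using nonneg[of "{}"] s by (intro mult_right_mono) auto
    ultimately show ?thesis by simp
  next
    case 2
    let ?i = "best c" and ?w = "opt v c (affordable c - {best c}) B"
    have iA: "?i \<in> A" and UA: "U \<subseteq> A" using best_props(1)[OF 2(1)] U(1) by auto
    \<comment> \<open>An optimal set without the best item competes in \<open>?w\<close>, and
      restoring that item adds at most its own value.\<close>
    have "sum c (U - {?i}) \<le> sum c U"
      using UA c finite_subset[OF UA finite_A] by (intro sum_mono2) (auto simp: cost_vectors_def)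
    then have "v (U - {?i}) \<le> ?w" using U finite_A by (intro opt_ge) auto
    moreover have "v U \<le> v ((U - {?i}) \<union> {?i})" using UA iA by (intro v_mono) auto
    moreover have "v ((U - {?i}) \<union> {?i}) \<le> v (U - {?i}) + v {?i}"
      using UA iA by (intro v_insert_le) auto
    ultimately have "v U \<le> ?w + v {?i}" by linarith
    moreover have "?w \<le> (?s + 3) / 2 * v {?i}"
    proof -
      \<comment> \<open>The factor \<open>(?s + 3) / 2\<close> is the inverse of
        \<open>(?s - 3) / 4\<close>, since \<open>?s * ?s - 9 = 8\<close>.\<close>
      have "(?s + 3) / 2 * ((?s - 3) / 4 * ?w) \<le> (?s + 3) / 2 * v {?i}"
        using 2(2) s unfolding single_def by (intro mult_left_mono) auto
      moreover have "(?s + 3) / 2 * ((?s - 3) / 4 * ?w) = (?s * ?s - 9) / 8 * ?w"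
        by (simp add: field_simps)
      ultimately have "(?s * ?s - 9) / 8 * ?w \<le> (?s + 3) / 2 * v {?i}" by (simp only:)
      then show ?thesis unfolding s(1) by simp
    qed
    moreover have "mech c = {?i}" using 2 by (simp add: mech_eq)
    ultimately show ?thesis using opt U(3) by (simp add: field_simps)
  next
    case 3
    let ?O = "opt v c (affordable c) B"
    have mech: "mech c = greedy_eom r v (1/2) (affordable c) B c" using 3 by (simp add: mech_eq)
    have "?O / 2 \<le> v (mech c) + v {best c}"
      unfolding mech
      using best_props[OF 3(1)] not_single_opt_pos(2)[OF 3] nonneg[of "{best c}"]
      by (intro greedy_eom_value) auto
    \<comment> \<open>Here \<open>(5 - ?s) / 4 = 1/2 - (?s - 3) / 4\<close>. Its inverse is
      \<open>(5 + ?s) / 2\<close>, since \<open>25 - ?s * ?s = 8\<close>.\<close>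
    then have "(5 - ?s) / 4 * ?O \<le> v (mech c)"
      using not_single_opt_pos(1)[OF 3] by (simp add: field_simps)
    then have "(5 + ?s) / 2 * ((5 - ?s) / 4 * ?O) \<le> (5 + ?s) / 2 * v (mech c)"
      using s by (intro mult_left_mono) auto
    moreover have "(5 + ?s) / 2 * ((5 - ?s) / 4 * ?O) = (25 - ?s * ?s) / 8 * ?O"
      by (simp add: field_simps)
    ultimately have "(25 - ?s * ?s) / 8 * ?O \<le> (5 + ?s) / 2 * v (mech c)" by (simp only:)
    then show ?thesis unfolding s(1) opt by simp
  qed
qed

end

theorem theorem3p10:
  fixes A :: "'a set" and v :: "'a set \<Rightarrow> real" and B :: real
    and r r' :: "('a \<times> 'a) set"
  assumes "finite A" and "0 < B"
    and "\<And>S. S \<subseteq> A \<Longrightarrow> 0 \<le> v S"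
    and "mono_on (Pow A) v"
    and "submodular_on A v"
    and "linear_order_on A r" and "linear_order_on A r'"
  shows "truthful A (deterministic_eom r r' v A B)
           (threshold_payment (deterministic_eom r r' v A B))
       \<and> budget_feasible A B (threshold_payment (deterministic_eom r r' v A B))
       \<and> has_approximation_ratio A v B (deterministic_eom r r' v A B) ((5 + sqrt 17) / 2)
       \<and> \<bar>(5 + sqrt 17) / 2 - 4.56\<bar> < (0.005 :: real)"
proof -
  interpret deterministic_mechanism A v r r' B
    using assms by unfold_locales auto
  \<comment> \<open>These bounds place the exact ratio between 4.5615 and 4.562, which rounds to
    4.56.\<close>
  have "4.123 < sqrt (17 :: real)" "sqrt (17 :: real) < 4.124"
    by (rule real_less_rsqrt real_less_lsqrt; simp add: power2_eq_square)+
  then have "\<bar>(5 + sqrt 17) / 2 - 4.56\<bar> < (0.005 :: real)" by (simp add: abs_if)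
  then show ?thesis using mech_truthful mech_budget_feasible mech_approximation by blast
qed

end
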